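(* Let $d \geq 3$. The following hold. (1) For any $n \geq 2d$, $m^m(n,d) = \frac{2^d}{d!}$. Furthermore, $\mu_n^{m}(B) = m^m(n,d)$ for $B \in \mathcal{K}^d_o$ whenever $B$ is a cross-polytope. (2) For $d+1\leq n\leq 2d-1$, $m^m(n,d) = \frac{2^d}{d!\cdot 2^{2d-n}}$, and $\mu_n^{m}(B) = m^m(n,d)$ for $B \in \mathcal{K}^d_o$ whenever $B$ is a cross-polytope.
   Context: $\lambda_d$ denotes $d$-dimensional Lebesgue measure on $\mathbb{R}^d$; $o$ is the origin. $\mathcal{K}^d_o$ is the family of $o$-symmetric convex bodies (compact convex sets with nonempty interior) in $\mathbb{R}^d$. A cross-polytope is a set of the form $\operatorname{conv}\{\pm q_1,\dots,\pm q_d\}$ with $q_1,\dots,q_d\in\mathbb{R}^d$ linearly independent. For $B\in\mathcal{K}^d_o$, let $I(B)$ be a maximum volume cross-polytope contained in $B$. Gromov's mass of a set $S\subset\mathbb{R}^d$ in the normed space with unit ball $B$ is the multiple of Lebesgue measure normalized so that $I(B)$ has measure $\frac{2^d}{d!}$, i.e. $\operatorname{vol}^{m}_B(S)=\frac{2^d}{d!}\cdot\frac{\lambda_d(S)}{\lambda_d(I(B))}$. For $n\ge d+1$, $$\mu_n^{m}(B)=\sup\{\operatorname{vol}_B^{m}(Q): Q \text{ is a convex polytope contained in } B \text{ with at most } n \text{ vertices}\},$$ and $m^{m}(n,d)=\inf\{\mu_n^{m}(B): B\in\mathcal{K}^d_o\}$. *)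

theory Defs
  imports "HOL-Analysis.Analysis"
begin

definition sym_convex_bodies :: "(real^'d) set set" where
  "sym_convex_bodies =
     {B. compact B \<and> convex B \<and> interior B \<noteq> {} \<and> uminus ` B = B}"

definition cross_polytope :: "(real^'d) set \<Rightarrow> bool" where
  "cross_polytope C \<longleftrightarrow>
     (\<exists>q :: 'd \<Rightarrow> real^'d. inj q \<and> independent (range q) \<and>
        C = convex hull (range q \<union> uminus ` range q))"

definition is_max_cross_polytope :: "(real^'d) set \<Rightarrow> (real^'d) set \<Rightarrow> bool" where
  "is_max_cross_polytope B C \<longleftrightarrow>
     cross_polytope C \<and> C \<subseteq> B \<and>
     (\<forall>C'. cross_polytope C' \<and> C' \<subseteq> B \<longrightarrow> measure lebesgue C' \<le> measure lebesgue C)"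

text \<open>A maximiser need not be unique, so one is chosen; only its volume is used below, and
  all maximisers have the same volume.\<close>

definition max_cross_polytope :: "(real^'d) set \<Rightarrow> (real^'d) set" where
  "max_cross_polytope B = (SOME C. is_max_cross_polytope B C)"

text \<open>Real-valued, hence meaningful for sets of finite Lebesgue measure only; it is applied
  to polytopes.\<close>

definition gromov_mass :: "(real^'d) set \<Rightarrow> (real^'d) set \<Rightarrow> real" where
  "gromov_mass B S =
     2 ^ CARD('d) / fact CARD('d) *
       (measure lebesgue S / measure lebesgue (max_cross_polytope B))"

text \<open>The vertices of a polytope are its extreme points; there are finitely many, so
  \<^const>\<open>card\<close> counts them correctly.\<close>

definition gromov_mu :: "nat \<Rightarrow> (real^'d) set \<Rightarrow> real" where
  "gromov_mu n B =
     Sup {gromov_mass B Q | Q.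
            polytope Q \<and> Q \<subseteq> B \<and> card {v. v extreme_point_of Q} \<le> n}"

text \<open>The dimension is the cardinality of the index type, passed as a type argument.\<close>

definition gromov_m :: "nat \<Rightarrow> 'd::finite itself \<Rightarrow> real" where
  "gromov_m n _ = Inf {gromov_mu n B | B :: (real^'d) set. B \<in> sym_convex_bodies}"

end

theory Submission
  imports Defs
begin

text \<open>The lower bound for \<open>\<mu>\<^sub>n\<close> comes from the convex hull of \<open>n\<close> vertices of a maximum volume
  cross-polytope, chosen so that \<open>n - d\<close> antipodal pairs are kept: it consists of \<open>2 ^ (n - d)\<close>
  of the \<open>2 ^ d\<close> simplices into which the coordinate hyperplanes cut the cross-polytope.

  For the upper bound in a cross-polytope, the volume of the convex hull of finitely many points is a
  convex function of each single point. Hence, among polytopes with at most \<open>n\<close> vertices inside a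
  cross-polytope, the volume is maximal when all vertices are vertices of the cross-polytope, and then
  the polytope is covered by at most \<open>2 ^ (n - d)\<close> of the orthant simplices or lies in a hyperplane.\<close>

subsection \<open>Convexity of the volume of a convex hull\<close>

text \<open>Integrating over a slab of unit width in the parameter along \<open>v\<close> replaces the integral over the
  orthogonal complement of \<open>v\<close>, which is not a space of the same type.\<close>

lemma emeasure_lborel_eq_nn_integral_slices:
  fixes S :: "'a::euclidean_space set"
  assumes S [measurable]: "S \<in> sets borel" and v: "v \<noteq> 0"
  shows "emeasure lborel S =
    (\<integral>\<^sup>+y. indicator {y. 0 \<le> y \<bullet> v \<and> y \<bullet> v < v \<bullet> v} y * emeasure lborel {s. y + s *\<^sub>R v \<in> S} \<partial>lborel)"
proof -
  define W where "W = {y. 0 \<le> y \<bullet> v \<and> y \<bullet> v < v \<bullet> v}"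
  have W [measurable]: "W \<in> sets borel"
    unfolding W_def by measurable
  have [measurable]: "(\<lambda>y. y + s *\<^sub>R v) \<in> borel_measurable borel" for s by measurable
  have slice: "{s. y + s *\<^sub>R v \<in> S} \<in> sets borel" for y
    by measurable
  have vv: "v \<bullet> v > 0" using v by simp
  have "(\<integral>\<^sup>+y. indicator W y * emeasure lborel {s. y + s *\<^sub>R v \<in> S} \<partial>lborel)
      = (\<integral>\<^sup>+y. \<integral>\<^sup>+s. indicator W y * indicator S (y + s *\<^sub>R v) \<partial>lborel \<partial>lborel)"
  proof (intro nn_integral_cong)
    fix y
    have "emeasure lborel {s. y + s *\<^sub>R v \<in> S} = (\<integral>\<^sup>+s. indicator {s. y + s *\<^sub>R v \<in> S} s \<partial>lborel)"
      using slice by simp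
    also have "\<dots> = (\<integral>\<^sup>+s. indicator S (y + s *\<^sub>R v) \<partial>lborel)"
      by (intro nn_integral_cong) (simp add: indicator_def)
    finally show "indicator W y * emeasure lborel {s. y + s *\<^sub>R v \<in> S}
        = (\<integral>\<^sup>+s. indicator W y * indicator S (y + s *\<^sub>R v) \<partial>lborel)"
      by (simp add: nn_integral_cmult)
  qed
  also have "\<dots> = (\<integral>\<^sup>+s. \<integral>\<^sup>+y. indicator W y * indicator S (y + s *\<^sub>R v) \<partial>lborel \<partial>lborel)"
    by (rule lborel_pair.Fubini'[symmetric]) measurable
  \<comment> \<open>For fixed \<open>s\<close>, substitute \<open>z = y + s *\<^sub>R v\<close>;
    translations preserve Lebesgue measure.\<close>
  also have "\<dots> = (\<integral>\<^sup>+s. \<integral>\<^sup>+z. indicator W (z - s *\<^sub>R v) * indicator S z \<partial>lborel \<partial>lborel)"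
  proof (rule nn_integral_cong)
    fix s :: real
    have "(\<integral>\<^sup>+y. indicator W y * indicator S (y + s *\<^sub>R v) \<partial>lborel)
        = (\<integral>\<^sup>+y. indicator W y * indicator S (y + s *\<^sub>R v) \<partial>distr lborel borel ((+) (- s *\<^sub>R v)))"
      by (simp only: lborel_distr_plus)
    also have "\<dots> = (\<integral>\<^sup>+z. indicator W (z - s *\<^sub>R v) * indicator S z \<partial>lborel)"
      by (subst nn_integral_distr) auto
    finally show "(\<integral>\<^sup>+y. indicator W y * indicator S (y + s *\<^sub>R v) \<partial>lborel)
      = (\<integral>\<^sup>+z. indicator W (z - s *\<^sub>R v) * indicator S z \<partial>lborel)" .
  qed
  also have "\<dots> = (\<integral>\<^sup>+z. \<integral>\<^sup>+s. indicator W (z - s *\<^sub>R v) * indicator S z \<partial>lborel \<partial>lborel)"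
    by (rule lborel_pair.Fubini') measurable
  also have "\<dots> = (\<integral>\<^sup>+z. indicator S z \<partial>lborel)"
  proof (intro nn_integral_cong)
    fix z
    \<comment> \<open>For fixed \<open>z\<close>, the parameters that bring \<open>z\<close> back
      into the slab form a half-open interval of length one, so each \<open>z\<close> is counted
      exactly once.\<close>
    have "indicator W (z - s *\<^sub>R v)
        = (indicator {(z \<bullet> v) / (v \<bullet> v) - 1 <.. (z \<bullet> v) / (v \<bullet> v)} s :: ennreal)" for s
      using vv by (auto simp: W_def indicator_def inner_diff_left field_simps)
    then have "(\<integral>\<^sup>+s. indicator W (z - s *\<^sub>R v) * indicator S z \<partial>lborel)
        = (\<integral>\<^sup>+s. indicator {(z \<bullet> v) / (v \<bullet> v) - 1 <.. (z \<bullet> v) / (v \<bullet> v)} s \<partial>lborel) * indicator S z"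
      by (simp add: nn_integral_multc)
    then show "(\<integral>\<^sup>+s. indicator W (z - s *\<^sub>R v) * indicator S z \<partial>lborel) = indicator S z"
      by simp
  qed
  also have "\<dots> = emeasure lborel S"
    by simp
  finally show ?thesis
    by (simp add: W_def)
qed

text \<open>Nonempty compact convex subsets of the line are intervals \<open>{a..b}\<close> and
  \<open>{c..d}\<close>. All combinations lie in one interval whose length is the weighted sum of
  the two lengths.\<close>

lemma emeasure_le_of_minkowski_combination:
  fixes R S T :: "real set"
  assumes S: "compact S" "convex S" and T: "compact T" "convex T" and uv: "0 \<le> u" "0 \<le> v"
    and comb: "\<And>r. r \<in> R \<Longrightarrow> \<exists>s\<in>S. \<exists>t\<in>T. r = u * s + v * t"
  shows "emeasure lborel R \<le> ennreal u * emeasure lborel S + ennreal v * emeasure lborel T"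
proof (cases "R = {}")
  case False
  then have ne: "S \<noteq> {}" "T \<noteq> {}"
    using comb by auto
  obtain a b where ab: "S = {a..b}"
    using S connected_compact_interval_1 convex_connected by (metis cbox_interval)
  obtain c d where cd: "T = {c..d}"
    using T connected_compact_interval_1 convex_connected by (metis cbox_interval)
  have le: "a \<le> b" "c \<le> d"
    using ne ab cd by auto
  have "R \<subseteq> {u * a + v * c .. u * b + v * d}"
  proof
    fix r assume "r \<in> R"
    then obtain s t where "s \<in> S" "t \<in> T" "r = u * s + v * t"
      using comb by blast
    then show "r \<in> {u * a + v * c .. u * b + v * d}"
      using uv ab cd by (auto intro!: add_mono mult_left_mono)
  qed
  then have "emeasure lborel R \<le> emeasure lborel {u * a + v * c .. u * b + v * d}"
    by (intro emeasure_mono) auto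
  also have "\<dots> = ennreal ((u * b + v * d) - (u * a + v * c))"
    using le uv by (simp add: add_mono mult_left_mono)
  also have "\<dots> = ennreal (u * (b - a) + v * (d - c))"
    by (simp add: algebra_simps)
  also have "\<dots> = ennreal u * emeasure lborel S + ennreal v * emeasure lborel T"
    using le uv ab cd by (simp add: ennreal_plus ennreal_mult)
  finally show ?thesis .
qed auto

text \<open>Along a line, moving one point only slides each chord's endpoints: the set of lines in that
  direction meeting the hull does not change, and the chords vary in a Minkowski-convex way.\<close>

lemma convex_on_measure_convex_hull_insert:
  fixes P :: "'a::euclidean_space set"
  assumes P: "finite P"
  shows "convex_on UNIV (\<lambda>x. measure lebesgue (convex hull (insert x P)))"
proof (cases "P = {}")
  case True
  then show ?thesis by (simp add: convex_on_const)
next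
  case False
  let ?H = "\<lambda>x. convex hull (insert x P)"
  have cpt: "compact (?H x)" for x
    using P by (simp add: finite_imp_compact_convex_hull)
  have borel [measurable]: "?H x \<in> sets borel" for x
    using cpt by (simp add: borel_compact)
  show ?thesis
  proof (rule convex_onI)
    fix t :: real and a b :: 'a
    assume t: "0 < t" "t < 1"
    define v where "v = b - a"
    define x where "x = (1 - t) *\<^sub>R a + t *\<^sub>R b"
    have "measure lebesgue (?H x) \<le> (1 - t) * measure lebesgue (?H a) + t * measure lebesgue (?H b)"
    proof (cases "v = 0")
      case True
      then show ?thesis by (simp add: v_def x_def algebra_simps flip: scaleR_add_left)
    next
      case False
      let ?W = "{y. 0 \<le> y \<bullet> v \<and> y \<bullet> v < v \<bullet> v}"
      have [measurable]: "?W \<in> sets borel" by measurable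
      let ?L = "\<lambda>z y. {s. y + s *\<^sub>R v \<in> ?H z}"
      have cc: "compact (?L z y)" "convex (?L z y)" for z y
      proof -
        have eq: "?L z y = (\<lambda>s. y + s *\<^sub>R v) -` ?H z" by auto
        have "closed (?L z y)"
          unfolding eq using cpt
          by (intro closed_vimage) (auto intro!: continuous_intros compact_imp_closed)
        moreover have "bounded (?L z y)"
        proof -
          obtain B where B: "\<And>w. w \<in> ?H z \<Longrightarrow> norm w \<le> B"
            using cpt compact_imp_bounded bounded_iff by metis
          have "\<bar>s\<bar> \<le> (B + norm y) / norm v" if "s \<in> ?L z y" for s
          proof -
            have "norm (s *\<^sub>R v) \<le> norm (y + s *\<^sub>R v) + norm y"
              using norm_triangle_ineq4[of "y + s *\<^sub>R v" y] by simp
            also have "\<dots> \<le> B + norm y"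
              using B that by simp
            finally show ?thesis using \<open>v \<noteq> 0\<close> by (simp add: field_simps)
          qed
          then show ?thesis
            unfolding bounded_iff by (auto simp del: mem_Collect_eq)
        qed
        ultimately show "compact (?L z y)" by (simp add: compact_eq_bounded_closed)
        show "convex (?L z y)"
        proof (rule convexI)
          fix s s' u w :: real
          assume *: "s \<in> ?L z y" "s' \<in> ?L z y" "0 \<le> u" "0 \<le> w" "u + w = 1"
          then have "u *\<^sub>R (y + s *\<^sub>R v) + w *\<^sub>R (y + s' *\<^sub>R v) \<in> ?H z"
            by (intro convexD) auto
          moreover have "u *\<^sub>R (y + s *\<^sub>R v) + w *\<^sub>R (y + s' *\<^sub>R v)
              = (u + w) *\<^sub>R y + (u *\<^sub>R s + w *\<^sub>R s') *\<^sub>R v"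
            by (simp add: algebra_simps)
          ultimately show "u *\<^sub>R s + w *\<^sub>R s' \<in> ?L z y"
            using * by simp
        qed
      qed
      have slice: "emeasure lborel (?L x y)
          \<le> ennreal (1 - t) * emeasure lborel (?L a y) + ennreal t * emeasure lborel (?L b y)" for y
      proof (rule emeasure_le_of_minkowski_combination[OF cc cc])
        fix s assume "s \<in> ?L x y"
        then obtain u w k where uw: "0 \<le> u" "0 \<le> w" "u + w = 1" and k: "k \<in> convex hull P"
          and eq: "y + s *\<^sub>R v = u *\<^sub>R x + w *\<^sub>R k"
          unfolding convex_hull_insert[OF \<open>P \<noteq> {}\<close>] by auto
        have ins: "u *\<^sub>R z + w *\<^sub>R k \<in> ?H z" for z
          using uw k unfolding convex_hull_insert[OF \<open>P \<noteq> {}\<close>] by auto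
        \<comment> \<open>Since \<open>a = x - t *\<^sub>R v\<close> and
          \<open>b = x + (1 - t) *\<^sub>R v\<close>, replacing \<open>x\<close> by \<open>a\<close>
          or \<open>b\<close> with the same \<open>u\<close>, \<open>w\<close>, \<open>k\<close>
          stays on the line through \<open>y\<close> and shifts \<open>s\<close> by
          \<open>- u * t\<close> or \<open>u * (1 - t)\<close>. The weighted mean of the two shifts
          is zero.\<close>
        have "y + (s - u * t) *\<^sub>R v = u *\<^sub>R a + w *\<^sub>R k"
          using eq by (simp add: x_def v_def algebra_simps)
        then have 1: "s - u * t \<in> ?L a y"
          using ins by simp
        have "y + (s + u * (1 - t)) *\<^sub>R v = (y + s *\<^sub>R v) + (u * (1 - t)) *\<^sub>R v"
          by (simp add: algebra_simps)
        also have "\<dots> = u *\<^sub>R b + w *\<^sub>R k"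
          unfolding eq by (simp add: x_def v_def algebra_simps)
        finally have 2: "s + u * (1 - t) \<in> ?L b y"
          using ins by simp
        have "s = (1 - t) * (s - u * t) + t * (s + u * (1 - t))"
          by (simp add: algebra_simps)
        with 1 2 show "\<exists>s'\<in>?L a y. \<exists>s''\<in>?L b y. s = (1 - t) * s' + t * s''"
          by blast
      qed (use t in auto)
      have [measurable]: "(\<lambda>y. emeasure lborel (?L z y)) \<in> borel_measurable borel" for z
      proof -
        \<comment> \<open>The chord length is measurable in \<open>y\<close> because the chords are
          the sections of one Borel set of pairs \<open>(y, s)\<close>.\<close>
        have "{p\<in>space (borel \<Otimes>\<^sub>M lborel). fst p + snd p *\<^sub>R v \<in> ?H z} \<in> sets (borel \<Otimes>\<^sub>M lborel)"
          by measurable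
        from lborel.measurable_emeasure_Pair[OF this] show ?thesis
          by (simp add: vimage_def space_pair_measure)
      qed
      have "emeasure lborel (?H x) = (\<integral>\<^sup>+y. indicator ?W y * emeasure lborel (?L x y) \<partial>lborel)"
        by (rule emeasure_lborel_eq_nn_integral_slices[OF borel \<open>v \<noteq> 0\<close>])
      also have "\<dots> \<le> (\<integral>\<^sup>+y. indicator ?W y * (ennreal (1 - t) * emeasure lborel (?L a y)
           + ennreal t * emeasure lborel (?L b y)) \<partial>lborel)"
        by (intro nn_integral_mono mult_left_mono slice) auto
      also have "\<dots> = (\<integral>\<^sup>+y. ennreal (1 - t) * (indicator ?W y * emeasure lborel (?L a y))
           + ennreal t * (indicator ?W y * emeasure lborel (?L b y)) \<partial>lborel)"
        by (intro nn_integral_cong) (simp add: distrib_left mult_ac)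
      also have "\<dots> = ennreal (1 - t) * (\<integral>\<^sup>+y. indicator ?W y * emeasure lborel (?L a y) \<partial>lborel)
           + ennreal t * (\<integral>\<^sup>+y. indicator ?W y * emeasure lborel (?L b y) \<partial>lborel)"
        by (simp add: nn_integral_add nn_integral_cmult)
      also have "\<dots> = ennreal (1 - t) * emeasure lborel (?H a) + ennreal t * emeasure lborel (?H b)"
        by (simp only: emeasure_lborel_eq_nn_integral_slices[OF borel \<open>v \<noteq> 0\<close>])
      finally have le: "emeasure lborel (?H x)
        \<le> ennreal (1 - t) * emeasure lborel (?H a) + ennreal t * emeasure lborel (?H b)" .
      have em: "emeasure lborel (?H z) = ennreal (measure lebesgue (?H z))" for z
        using emeasure_bounded_finite[OF compact_imp_bounded[OF cpt], of z]
        by (simp add: measure_completion emeasure_eq_ennreal_measure)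
      show ?thesis
        using le t unfolding em by (simp flip: ennreal_mult ennreal_plus)
    qed
    then show "measure lebesgue (?H ((1 - t) *\<^sub>R a + t *\<^sub>R b))
      \<le> (1 - t) * measure lebesgue (?H a) + t * measure lebesgue (?H b)"
      by (simp add: x_def)
  qed auto
qed

text \<open>A convex function on \<open>convex hull V\<close> is bounded by its values on
  \<open>V\<close>, so the points of \<open>P\<close> can be replaced one at a time by points of
  \<open>V\<close>, and their number never increases.\<close>

lemma measure_convex_hull_le_of_vertices:
  fixes V :: "'a::euclidean_space set"
  assumes V: "\<And>A. finite A \<Longrightarrow> A \<subseteq> V \<Longrightarrow> card A \<le> n \<Longrightarrow> measure lebesgue (convex hull A) \<le> m"
    and P: "finite P" "P \<subseteq> convex hull V" "card P \<le> n"
  shows "measure lebesgue (convex hull P) \<le> m"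
proof -
  \<comment> \<open>\<open>A\<close> collects the points already moved into \<open>V\<close>,
    \<open>P\<close> those still to be moved.\<close>
  have "measure lebesgue (convex hull (A \<union> P)) \<le> m"
    if "finite A" "A \<subseteq> V" "card A + card P \<le> n" for A
    using \<open>finite P\<close> \<open>P \<subseteq> convex hull V\<close> that
  proof (induction P arbitrary: A rule: finite_induct)
    case empty
    then show ?case using V by simp
  next
    case (insert x P)
    have "convex_on (convex hull V) (\<lambda>x. measure lebesgue (convex hull (insert x (A \<union> P))))"
      using insert.hyps insert.prems
      by (intro convex_on_subset[OF convex_on_measure_convex_hull_insert]) auto
    moreover have "measure lebesgue (convex hull (insert y (A \<union> P))) \<le> m" if "y \<in> V" for y
      using insert.IH[of "insert y A"] insert.hyps insert.prems that
      by (simp add: card_insert_if split: if_splits)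
    ultimately show ?case
      using convex_on_convex_hull_bound insert.prems by fastforce
  qed
  from this[of "{}"] P show ?thesis by simp
qed

subsection \<open>Volume under linear maps\<close>

text \<open>The map sends every line parallel to \<open>v\<close> to itself, acting there as an
  affine map with factor \<open>1 + v \<bullet> w\<close>, which is also its determinant. Chord
  lengths along \<open>v\<close> are therefore preserved. Shears have
  \<open>v \<bullet> w = 0\<close>, reflections \<open>v \<bullet> w = -2\<close>.\<close>

lemma measure_rank_one_update:
  fixes v w :: "'a::euclidean_space"
  assumes S: "compact S" and v: "v \<noteq> 0" and c: "\<bar>1 + v \<bullet> w\<bar> = 1"
  shows "measure lebesgue ((\<lambda>x. x + (x \<bullet> w) *\<^sub>R v) ` S) = measure lebesgue S"
proof -
  let ?f = "\<lambda>x. x + (x \<bullet> w) *\<^sub>R v"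
  let ?L = "\<lambda>S y. {s. y + s *\<^sub>R v \<in> S}"
  have fS: "compact (?f ` S)"
    using S by (intro compact_continuous_image continuous_intros)
  have L: "?L T y \<in> sets borel" if "compact T" for T y
  proof -
    have "closed ((\<lambda>s. y + s *\<^sub>R v) -` T)"
      using that by (intro closed_vimage compact_imp_closed continuous_intros)
    then show ?thesis
      by (simp add: vimage_def)
  qed
  have slice: "?L (?f ` S) y = (\<lambda>s. (1 + v \<bullet> w) *\<^sub>R s + y \<bullet> w) ` ?L S y" for y
  proof (intro subset_antisym subsetI)
    fix s assume "s \<in> ?L (?f ` S) y"
    then obtain x where x: "x \<in> S" "y + s *\<^sub>R v = x + (x \<bullet> w) *\<^sub>R v" by auto
    \<comment> \<open>\<open>r\<close> is the parameter of the preimage \<open>x\<close> on the line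
      through \<open>y\<close>.\<close>
    define r where "r = s - x \<bullet> w"
    have xr: "x = y + r *\<^sub>R v"
      using x(2) by (simp add: r_def algebra_simps)
    then have "x \<bullet> w = y \<bullet> w + r * (v \<bullet> w)"
      by (simp add: inner_add_left)
    then have "s = (1 + v \<bullet> w) *\<^sub>R r + y \<bullet> w"
      by (simp add: r_def algebra_simps)
    moreover have "r \<in> ?L S y"
      using x(1) xr by simp
    ultimately show "s \<in> (\<lambda>s. (1 + v \<bullet> w) *\<^sub>R s + y \<bullet> w) ` ?L S y"
      by blast
  next
    fix s assume "s \<in> (\<lambda>s. (1 + v \<bullet> w) *\<^sub>R s + y \<bullet> w) ` ?L S y"
    then obtain r where r: "y + r *\<^sub>R v \<in> S" "s = (1 + v \<bullet> w) *\<^sub>R r + y \<bullet> w" by auto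
    have "y + s *\<^sub>R v = ?f (y + r *\<^sub>R v)"
      unfolding r(2) by (simp add: inner_add_left algebra_simps)
    then show "s \<in> ?L (?f ` S) y"
      using r(1) by blast
  qed
  have "emeasure lborel (?L (?f ` S) y) = emeasure lborel (?L S y)" for y
  proof -
    have "emeasure lebesgue (?L (?f ` S) y) = emeasure lebesgue (?L S y)"
      unfolding slice emeasure_lebesgue_affine using c by simp
    then show ?thesis
      using L[OF S] L[OF fS] by (simp add: emeasure_completion)
  qed
  then have "emeasure lborel (?f ` S) = emeasure lborel S"
    unfolding emeasure_lborel_eq_nn_integral_slices[OF borel_compact[OF S] v]
      emeasure_lborel_eq_nn_integral_slices[OF borel_compact[OF fS] v] by simp
  then have "measure lborel (?f ` S) = measure lborel S"
    by (simp add: measure_def)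
  then show ?thesis
    using S fS by (simp add: measure_completion borel_compact)
qed

text \<open>The library's version requires the index type to be well-ordered.\<close>

lemma measure_linear_image_compact:
  fixes f :: "real^'n \<Rightarrow> real^'n"
  assumes "linear f" "compact S"
  shows "measure lebesgue (f ` S) = \<bar>det (matrix f)\<bar> * measure lebesgue S"
proof -
  have axis [simp]: "axis k (1::real) $ i = (if i = k then 1 else 0)" for i k :: 'n
    by (simp add: axis_def)
  have "\<forall>S. compact S \<longrightarrow> measure lebesgue (f ` S) = \<bar>det (matrix f)\<bar> * measure lebesgue S"
  \<comment> \<open>The cases are compositions, maps with a vanishing coordinate, diagonal maps,
    coordinate swaps and shears.\<close>
  proof (rule induct_linear_elementary[OF \<open>linear f\<close>]; intro allI impI)
    fix f g :: "real^'n \<Rightarrow> real^'n" and S :: "(real^'n) set"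
    assume fg: "linear f" "linear g" and "compact S"
      and IH: "\<forall>S. compact S \<longrightarrow> measure lebesgue (f ` S) = \<bar>det (matrix f)\<bar> * measure lebesgue S"
        "\<forall>S. compact S \<longrightarrow> measure lebesgue (g ` S) = \<bar>det (matrix g)\<bar> * measure lebesgue S"
    have "compact (g ` S)"
      using fg \<open>compact S\<close> by (intro compact_continuous_image linear_continuous_on linear_conv_bounded_linear[THEN iffD1])
    then show "measure lebesgue ((f \<circ> g) ` S) = \<bar>det (matrix (f \<circ> g))\<bar> * measure lebesgue S"
      unfolding image_comp[symmetric]
      using IH \<open>compact S\<close> by (simp add: matrix_compose fg det_mul abs_mult)
  next
    fix f :: "real^'n \<Rightarrow> real^'n" and i and S :: "(real^'n) set"
    assume f: "linear f" "\<And>x. f x $ i = 0"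
    have "f ` S \<subseteq> {x. x $ i = 0}"
      using f(2) by auto
    then have "measure lebesgue (f ` S) = 0"
      using negligible_imp_measure0 negligible_subset negligible_standard_hyperplane_cart by blast
    moreover have "row i (matrix f) = 0"
      using f(2) by (simp add: row_def matrix_def vec_eq_iff)
    then have "det (matrix f) = 0"
      by (rule det_zero_row)
    ultimately show "measure lebesgue (f ` S) = \<bar>det (matrix f)\<bar> * measure lebesgue S"
      by simp
  next
    fix c :: "'n \<Rightarrow> real" and S :: "(real^'n) set"
    assume "compact S"
    have "det (matrix (\<lambda>x::real^'n. \<chi> i. c i * x $ i)) = prod c UNIV"
      by (subst det_diagonal) (auto simp: matrix_def axis_def)
    then show "measure lebesgue ((\<lambda>x. \<chi> i. c i * x $ i) ` S)
        = \<bar>det (matrix (\<lambda>x. \<chi> i. c i * x $ i))\<bar> * measure lebesgue S"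
      using \<open>compact S\<close> by (simp add: measure_stretch lmeasurable_compact)
  next
    fix m n :: 'n and S :: "(real^'n) set"
    assume mn: "m \<noteq> n" and "compact S"
    let ?h = "\<lambda>x::real^'n. \<chi> i. x $ Transposition.transpose m n i"
    let ?u = "axis m 1 - axis n 1 :: real^'n"
    \<comment> \<open>Swapping two coordinates is the reflection in the hyperplane orthogonal to
      \<open>?u\<close>; the factor is right because \<open>?u \<bullet> ?u = 2\<close>.\<close>
    have "?h = (\<lambda>x. x + (x \<bullet> (- ?u)) *\<^sub>R ?u)"
      using mn by (auto simp: fun_eq_iff vec_eq_iff inner_diff_right inner_axis Transposition.transpose_def)
    moreover have "?u \<noteq> 0" "\<bar>1 + ?u \<bullet> (- ?u)\<bar> = 1"
      using mn by (auto simp: axis_eq_axis inner_diff_left inner_diff_right inner_axis_axis)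
    ultimately have "measure lebesgue (?h ` S) = measure lebesgue S"
      using measure_rank_one_update[OF \<open>compact S\<close>, of ?u "- ?u"] by metis
    moreover have "matrix ?h = (\<chi> i. mat 1 $ Transposition.transpose m n i)"
      by (auto simp: matrix_def mat_def axis_def vec_eq_iff)
    then have "det (matrix ?h) = of_int (sign (Transposition.transpose m n))"
      using det_permute_rows[OF permutes_swap_id[of m UNIV n], of "mat 1 :: real^'n^'n"] by simp
    then have "\<bar>det (matrix ?h)\<bar> = 1"
      by (simp add: sign_def)
    ultimately show "measure lebesgue (?h ` S) = \<bar>det (matrix ?h)\<bar> * measure lebesgue S"
      by simp
  next
    fix m n :: 'n and S :: "(real^'n) set"
    assume mn: "m \<noteq> n" and "compact S"
    let ?h = "\<lambda>x::real^'n. \<chi> i. if i = m then x $ m + x $ n else x $ i"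
    have "?h = (\<lambda>x. x + (x \<bullet> axis n 1) *\<^sub>R axis m 1)"
      by (auto simp: fun_eq_iff vec_eq_iff inner_axis)
    moreover have "(axis m 1 :: real^'n) \<noteq> 0" "\<bar>1 + axis m 1 \<bullet> (axis n 1 :: real^'n)\<bar> = 1"
      using mn by (auto simp: axis_eq_0_iff inner_axis_axis)
    ultimately have "measure lebesgue (?h ` S) = measure lebesgue S"
      using measure_rank_one_update[OF \<open>compact S\<close>, of "axis m 1" "axis n 1"] by metis
    moreover have "matrix ?h = (\<chi> k. if k = m then row m (mat 1) + 1 *s row n (mat 1) else row k (mat 1))"
      by (auto simp: matrix_def mat_def axis_def row_def vec_eq_iff)
    then have "det (matrix ?h) = 1"
      using det_row_operation[OF mn, of "mat 1 :: real^'n^'n" 1] by simp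
    ultimately show "measure lebesgue (?h ` S) = \<bar>det (matrix ?h)\<bar> * measure lebesgue S"
      by simp
  qed
  then show ?thesis
    using \<open>compact S\<close> by blast
qed

subsection \<open>Hulls of signed unit vectors\<close>

text \<open>\<open>S i\<close> holds the signs with which the \<open>i\<close>-th unit vector
  occurs. With \<open>S i\<close> a subset of \<open>{1, -1}\<close>, these are exactly the sets of
  vertices of the standard cross-polytope.\<close>

definition signed_axes :: "('d \<Rightarrow> real set) \<Rightarrow> (real^'d) set" where
  "signed_axes S = (\<Union>i. axis i ` S i)"

text \<open>For a sign vector \<sigma> this is the simplex with vertices 0 and
  \<open>axis i (\<sigma> i)\<close>, given by inequalities: the part of the l1 unit ball in one
  closed orthant.\<close>

definition orthant_simplex :: "('d::finite \<Rightarrow> real) \<Rightarrow> (real^'d) set" where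
  "orthant_simplex \<sigma> = {x. (\<forall>i. 0 \<le> \<sigma> i * x $ i) \<and> (\<Sum>i\<in>UNIV. \<sigma> i * x $ i) \<le> 1}"

lemma std_simplex_cart:
  "convex hull (insert 0 (Basis :: (real^'d) set)) = orthant_simplex (\<lambda>_. 1)"
proof -
  have "sum ((\<bullet>) x) Basis = (\<Sum>i\<in>UNIV. x $ i)" for x :: "real^'d"
    by (simp add: Basis_vec_def UNION_singleton_eq_range sum.reindex inj_on_def axis_eq_axis inner_axis)
  then show ?thesis
    unfolding std_simplex by (auto simp: orthant_simplex_def Basis_vec_def inner_axis)
qed

text \<open>Multiplying the coordinates by the signs \<sigma> is an involution that exchanges the
  positive orthant with the orthant of \<sigma>.\<close>

lemma orthant_simplex_eq_stretch:
  fixes \<sigma> :: "'d::finite \<Rightarrow> real"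
  assumes \<sigma>: "\<And>i. \<sigma> i \<in> {1, -1}"
  shows "orthant_simplex \<sigma> = (\<lambda>x. \<chi> i. \<sigma> i * x $ i) ` (convex hull (insert 0 Basis))"
proof -
  let ?f = "\<lambda>x::real^'d. \<chi> i. \<sigma> i * x $ i"
  have sq: "\<sigma> i * (\<sigma> i * c) = c" for i c
    using \<sigma>[of i] by auto
  have inv: "?f (?f x) = x" for x
    by (simp add: vec_eq_iff sq)
  have 1: "?f x \<in> orthant_simplex (\<lambda>_. 1)" if "x \<in> orthant_simplex \<sigma>" for x
    using that by (simp add: orthant_simplex_def)
  have 2: "?f x \<in> orthant_simplex \<sigma>" if "x \<in> orthant_simplex (\<lambda>_. 1)" for x
    using that by (simp add: orthant_simplex_def sq)
  show ?thesis
    unfolding std_simplex_cart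
  proof
    show "orthant_simplex \<sigma> \<subseteq> ?f ` orthant_simplex (\<lambda>_. 1)"
    proof
      fix x assume "x \<in> orthant_simplex \<sigma>"
      then show "x \<in> ?f ` orthant_simplex (\<lambda>_. 1)"
        using image_eqI[of x ?f "?f x", OF inv[symmetric]] 1 by blast
    qed
  qed (use 2 in blast)
qed

lemma
  fixes \<sigma> :: "'d::finite \<Rightarrow> real"
  assumes \<sigma>: "\<And>i. \<sigma> i \<in> {1, -1}"
  shows lmeasurable_orthant_simplex: "orthant_simplex \<sigma> \<in> lmeasurable"
    and measure_orthant_simplex: "measure lebesgue (orthant_simplex \<sigma>) = 1 / fact CARD('d)"
proof -
  have cpt: "compact (convex hull (insert 0 (Basis :: (real^'d) set)))"
    by (simp add: finite_imp_compact_convex_hull)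
  then have m: "convex hull (insert 0 (Basis :: (real^'d) set)) \<in> lmeasurable"
    by (rule lmeasurable_compact)
  show "orthant_simplex \<sigma> \<in> lmeasurable"
    unfolding orthant_simplex_eq_stretch[OF \<sigma>] by (rule measurable_stretch[OF m])
  have "\<bar>prod \<sigma> UNIV\<bar> = 1"
    unfolding abs_prod
  proof (intro prod.neutral ballI)
    fix i show "\<bar>\<sigma> i\<bar> = 1" using \<sigma>[of i] by auto
  qed
  then show "measure lebesgue (orthant_simplex \<sigma>) = 1 / fact CARD('d)"
    unfolding orthant_simplex_eq_stretch[OF \<sigma>] measure_stretch[OF m]
    using content_std_simplex[where 'a="real^'d"] cpt by (simp add: measure_completion borel_compact)
qed

text \<open>All vertices of the simplex lie in the hull: the nonzero ones are in
  \<open>signed_axes S\<close>, and the origin is in the hull by assumption.\<close>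

lemma orthant_simplex_subset:
  fixes S :: "'d::finite \<Rightarrow> real set"
  assumes S: "\<And>i. S i \<subseteq> {1, -1}" and 0: "0 \<in> convex hull (signed_axes S)"
    and \<sigma>: "\<And>i. \<sigma> i \<in> S i"
  shows "orthant_simplex \<sigma> \<subseteq> convex hull (signed_axes S)"
proof -
  let ?f = "\<lambda>x::real^'d. \<chi> i. \<sigma> i * x $ i"
  have "linear ?f"
    by (intro linearI) (simp_all add: vec_eq_iff algebra_simps)
  have "orthant_simplex \<sigma> = ?f ` (convex hull (insert 0 Basis))"
    using S \<sigma> by (intro orthant_simplex_eq_stretch) blast
  also have "\<dots> = convex hull (?f ` insert 0 Basis)"
    by (rule convex_hull_linear_image[OF \<open>linear ?f\<close>])
  also have "\<dots> \<subseteq> convex hull (signed_axes S)"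
  proof (rule hull_minimal)
    have "?f (axis i 1) = axis i (\<sigma> i)" for i
      by (simp add: vec_eq_iff axis_def)
    moreover have "axis i (\<sigma> i) \<in> convex hull (signed_axes S)" for i
      using \<sigma> by (intro hull_inc) (auto simp: signed_axes_def)
    moreover have "?f 0 = 0"
      by (simp add: vec_eq_iff)
    ultimately show "?f ` insert 0 Basis \<subseteq> convex hull (signed_axes S)"
      using 0 by (auto simp: Basis_vec_def)
  qed simp
  finally show ?thesis .
qed

text \<open>The l1 norm is convex and equals 1 at every signed unit vector.\<close>

lemma l1_le_1_convex_hull_signed_axes:
  fixes S :: "'d::finite \<Rightarrow> real set"
  assumes S: "\<And>i. S i \<subseteq> {1, -1}" and x: "x \<in> convex hull (signed_axes S)"
  shows "(\<Sum>i\<in>UNIV. \<bar>x $ i\<bar>) \<le> 1"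
proof -
  let ?N = "\<lambda>x::real^'d. \<Sum>i\<in>UNIV. \<bar>x $ i\<bar>"
  have "convex_on UNIV ?N"
  proof (rule convex_onI)
    fix t :: real and x y :: "real^'d"
    assume t: "0 < t" "t < 1"
    have "?N ((1 - t) *\<^sub>R x + t *\<^sub>R y) \<le> (\<Sum>i\<in>UNIV. (1 - t) * \<bar>x $ i\<bar> + t * \<bar>y $ i\<bar>)"
    proof (intro sum_mono)
      fix i
      show "\<bar>((1 - t) *\<^sub>R x + t *\<^sub>R y) $ i\<bar> \<le> (1 - t) * \<bar>x $ i\<bar> + t * \<bar>y $ i\<bar>"
        using t abs_triangle_ineq[of "(1 - t) * x $ i" "t * y $ i"] by (simp add: abs_mult)
    qed
    then show "?N ((1 - t) *\<^sub>R x + t *\<^sub>R y) \<le> (1 - t) * ?N x + t * ?N y"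
      by (simp add: sum.distrib sum_distrib_left)
  qed simp
  then have "convex_on (convex hull (signed_axes S)) ?N"
    by (rule convex_on_subset) auto
  moreover have "\<forall>y\<in>signed_axes S. ?N y \<le> 1"
  proof
    fix y assume "y \<in> signed_axes S"
    then obtain i s where "y = axis i s" "s \<in> S i"
      by (auto simp: signed_axes_def)
    moreover have "?N (axis i s) = \<bar>s\<bar>"
      by (simp add: axis_def if_distrib[of abs] cong: if_cong)
    ultimately show "?N y \<le> 1"
      using S[of i] by auto
  qed
  ultimately show ?thesis
    using convex_on_convex_hull_bound x by blast
qed

text \<open>When the sign \<open>s\<close> is missing on axis \<open>i\<close>, all generating
  points lie in a half-space bounded by the \<open>i\<close>-th coordinate hyperplane, and so does
  their hull.\<close>

lemma convex_hull_signed_axes_component: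
  fixes S :: "'d::finite \<Rightarrow> real set"
  assumes S: "\<And>i. S i \<subseteq> {1, -1}" and x: "x \<in> convex hull (signed_axes S)"
    and s: "s \<in> {1, -1}" "s \<notin> S i"
  shows "s * x $ i \<le> 0"
proof -
  have "convex {y. inner (axis i s) y \<le> 0}"
    by (rule convex_halfspace_le)
  moreover have "inner (axis i s) y \<le> 0" if y: "y \<in> signed_axes S" for y
  proof -
    obtain j r where "y = axis j r" "r \<in> S j"
      using y by (auto simp: signed_axes_def)
    then show ?thesis
      using s S[of j] by (auto simp: inner_axis_axis)
  qed
  ultimately have "convex hull (signed_axes S) \<subseteq> {y. inner (axis i s) y \<le> 0}"
    by (intro hull_minimal) auto
  with x show ?thesis
    by (auto simp: inner_axis')
qed

lemma convex_hull_signed_axes_subset: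
  fixes S :: "'d::finite \<Rightarrow> real set"
  assumes S: "\<And>i. S i \<subseteq> {1, -1}" and ne: "\<And>i. S i \<noteq> {}"
  shows "convex hull (signed_axes S) \<subseteq> (\<Union>\<sigma>\<in>Pi\<^sub>E UNIV S. orthant_simplex \<sigma>)"
proof
  fix x assume x: "x \<in> convex hull (signed_axes S)"
  \<comment> \<open>A nonzero coordinate forces its own sign to occur in \<open>S i\<close>; for a
    zero coordinate any element of \<open>S i\<close> will do.\<close>
  have "\<exists>s. s \<in> S i \<and> s * x $ i = \<bar>x $ i\<bar>" for i
  proof (cases "x $ i = 0")
    case True
    then show ?thesis using ne[of i] by auto
  next
    case False
    then have "sgn (x $ i) \<in> {1, -1}" "sgn (x $ i) * x $ i > 0"
      by (auto simp: sgn_if)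
    then have "sgn (x $ i) \<in> S i"
      using convex_hull_signed_axes_component[OF S x, of "sgn (x $ i)" i] by fastforce
    moreover have "sgn (x $ i) * x $ i = \<bar>x $ i\<bar>"
      by (simp add: sgn_if)
    ultimately show ?thesis by blast
  qed
  then obtain \<sigma> where \<sigma>: "\<And>i. \<sigma> i \<in> S i" "\<And>i. \<sigma> i * x $ i = \<bar>x $ i\<bar>"
    by metis
  then have "x \<in> orthant_simplex \<sigma>"
    using l1_le_1_convex_hull_signed_axes[OF S x] by (simp add: orthant_simplex_def)
  then show "x \<in> (\<Union>\<sigma>\<in>Pi\<^sub>E UNIV S. orthant_simplex \<sigma>)"
    using \<sigma> by auto
qed

lemma finite_signed_axes:
  fixes S :: "'d::finite \<Rightarrow> real set"
  assumes S: "\<And>i. S i \<subseteq> {1, -1}"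
  shows "finite (signed_axes S)"
proof -
  have "finite (S i)" for i
    by (rule finite_subset[OF S]) simp
  then show ?thesis by (simp add: signed_axes_def)
qed

text \<open>The hull is covered by one orthant simplex of volume \<open>1 / fact CARD('d)\<close>
  for each choice of signs from \<open>S\<close>. If some axis has no sign, both sides are zero, as
  the hull is flat.\<close>

lemma measure_convex_hull_signed_axes_le:
  fixes S :: "'d::finite \<Rightarrow> real set"
  assumes S: "\<And>i. S i \<subseteq> {1, -1}"
  shows "measure lebesgue (convex hull (signed_axes S)) \<le> (\<Prod>i\<in>UNIV. card (S i)) / fact CARD('d)"
proof (cases "\<forall>i. S i \<noteq> {}")
  case True
  let ?U = "\<Union>\<sigma>\<in>Pi\<^sub>E UNIV S. orthant_simplex \<sigma>"
  have fin: "finite (Pi\<^sub>E UNIV S)"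
    by (intro finite_PiE) (auto intro: finite_subset[OF S])
  have pm: "\<sigma> i \<in> {1, -1}" if "\<sigma> \<in> Pi\<^sub>E UNIV S" for \<sigma> i
    using that S by blast
  have lm: "orthant_simplex \<sigma> \<in> lmeasurable" if "\<sigma> \<in> Pi\<^sub>E UNIV S" for \<sigma>
    by (intro lmeasurable_orthant_simplex pm that)
  have "measure lebesgue (convex hull (signed_axes S)) \<le> measure lebesgue ?U"
  proof (rule measure_mono_fmeasurable)
    show "convex hull (signed_axes S) \<subseteq> ?U"
      using convex_hull_signed_axes_subset S True by blast
    show "convex hull (signed_axes S) \<in> sets lebesgue"
      by (intro fmeasurableD lmeasurable_compact finite_imp_compact_convex_hull finite_signed_axes S)
    show "?U \<in> lmeasurable"
      using fin lm by (intro fmeasurable.finite_UN) auto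
  qed
  also have "\<dots> \<le> (\<Sum>\<sigma>\<in>Pi\<^sub>E UNIV S. measure lebesgue (orthant_simplex \<sigma>))"
    using fin lm by (intro measure_UNION_le) auto
  also have "\<dots> = (\<Sum>\<sigma>\<in>Pi\<^sub>E UNIV S. 1 / fact CARD('d))"
    by (intro sum.cong refl measure_orthant_simplex pm)
  finally show ?thesis
    by (simp add: card_PiE)
next
  case False
  then obtain i where i: "S i = {}" by blast
  have "x $ i = 0" if "x \<in> convex hull (signed_axes S)" for x
    using convex_hull_signed_axes_component[OF S that, of 1 i]
      convex_hull_signed_axes_component[OF S that, of "-1" i] i by simp
  then have "convex hull (signed_axes S) \<subseteq> {x. x $ i = 0}"
    by blast
  then have "negligible (convex hull (signed_axes S))"
    by (rule negligible_subset[OF negligible_standard_hyperplane_cart])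
  then show ?thesis
    by (simp add: negligible_imp_measure0 prod_nonneg)
qed

text \<open>Once the origin is in the hull, the covering simplices are contained in it, and they
  overlap only in coordinate hyperplanes.\<close>

lemma measure_convex_hull_signed_axes:
  fixes S :: "'d::finite \<Rightarrow> real set"
  assumes S: "\<And>i. S i \<subseteq> {1, -1}" and 0: "0 \<in> convex hull (signed_axes S)"
  shows "measure lebesgue (convex hull (signed_axes S)) = (\<Prod>i\<in>UNIV. card (S i)) / fact CARD('d)"
proof (rule antisym[OF measure_convex_hull_signed_axes_le[OF S]])
  let ?U = "\<Union>\<sigma>\<in>Pi\<^sub>E UNIV S. orthant_simplex \<sigma>"
  have fin: "finite (Pi\<^sub>E UNIV S)"
    by (intro finite_PiE) (auto intro: finite_subset[OF S])
  have pm: "\<sigma> i \<in> {1, -1}" if "\<sigma> \<in> Pi\<^sub>E UNIV S" for \<sigma> i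
    using that S by blast
  have lm: "orthant_simplex \<sigma> \<in> lmeasurable" if "\<sigma> \<in> Pi\<^sub>E UNIV S" for \<sigma>
    by (intro lmeasurable_orthant_simplex pm that)
  have "(\<Prod>i\<in>UNIV. card (S i)) / fact CARD('d) = (\<Sum>\<sigma>\<in>Pi\<^sub>E UNIV S. 1 / fact CARD('d))"
    by (simp add: card_PiE)
  also have "\<dots> = (\<Sum>\<sigma>\<in>Pi\<^sub>E UNIV S. measure lebesgue (orthant_simplex \<sigma>))"
    by (intro sum.cong refl measure_orthant_simplex[symmetric] pm)
  also have "\<dots> = measure lebesgue ?U"
  proof (rule measure_negligible_finite_Union_image[symmetric, OF fin lm])
    show "pairwise (\<lambda>\<sigma> \<tau>. negligible (orthant_simplex \<sigma> \<inter> orthant_simplex \<tau>)) (Pi\<^sub>E UNIV S)"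
    proof (rule pairwiseI)
      fix \<sigma> \<tau> assume *: "\<sigma> \<in> Pi\<^sub>E UNIV S" "\<tau> \<in> Pi\<^sub>E UNIV S" "\<sigma> \<noteq> \<tau>"
      then obtain i where i: "\<sigma> i \<noteq> \<tau> i" by blast
      have "\<sigma> i \<in> {1,-1}" "\<tau> i \<in> {1,-1}"
        using * pm by blast+
      with i have "\<tau> i = - \<sigma> i" "\<sigma> i \<noteq> 0"
        by auto
      then have "x $ i = 0" if "0 \<le> \<sigma> i * x $ i" "0 \<le> \<tau> i * x $ i" for x :: "real^'d"
        using that by (simp add: antisym)
      then have "orthant_simplex \<sigma> \<inter> orthant_simplex \<tau> \<subseteq> {x. x $ i = 0}"
        by (auto simp: orthant_simplex_def)
      then show "negligible (orthant_simplex \<sigma> \<inter> orthant_simplex \<tau>)"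
        by (rule negligible_subset[OF negligible_standard_hyperplane_cart])
    qed
  qed
  also have "\<dots> \<le> measure lebesgue (convex hull (signed_axes S))"
  proof (rule measure_mono_fmeasurable)
    show "?U \<subseteq> convex hull (signed_axes S)"
      using orthant_simplex_subset[OF S 0] by blast
    show "convex hull (signed_axes S) \<in> lmeasurable"
      by (intro lmeasurable_compact finite_imp_compact_convex_hull finite_signed_axes S)
    show "?U \<in> sets lebesgue"
      using fin lm by (intro sets.finite_UN) auto
  qed
  finally show "(\<Prod>i\<in>UNIV. card (S i)) / fact CARD('d) \<le> measure lebesgue (convex hull (signed_axes S))" .
qed

lemma zero_in_convex_hull_signed_axes:
  fixes S :: "'d::finite \<Rightarrow> real set"
  assumes "1 \<in> S i" "-1 \<in> S i"
  shows "0 \<in> convex hull (signed_axes S)"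
proof -
  have "axis i 1 \<in> convex hull (signed_axes S)" "axis i (-1) \<in> convex hull (signed_axes S)"
    using assms by (auto simp: signed_axes_def intro!: hull_inc)
  then have "(1/2) *\<^sub>R axis i 1 + (1/2) *\<^sub>R axis i (-1) \<in> convex hull (signed_axes S)"
    by (intro convexD) auto
  moreover have "(1/2) *\<^sub>R axis i 1 + (1/2) *\<^sub>R axis i (-1) = (0 :: real^'d)"
    by (simp add: vec_eq_iff axis_def)
  ultimately show ?thesis by metis
qed

text \<open>If \<open>A\<close> meets every axis, it contains \<open>card A - CARD('d)\<close>
  antipodal pairs, and each pair doubles the number of sign choices. If \<open>A\<close> misses an
  axis, there is no choice at all.\<close>

lemma measure_convex_hull_subset_signed_axes:
  fixes A :: "(real^'d::finite) set"
  assumes A: "A \<subseteq> signed_axes (\<lambda>_. {1, -1})" and n: "card A \<le> n" "CARD('d) \<le> n"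
  shows "measure lebesgue (convex hull A) \<le> 2 ^ (n - CARD('d)) / fact CARD('d)"
proof -
  define S where "S = (\<lambda>i::'d. {s \<in> {1, -1}. axis i s \<in> A})"
  have S: "S i \<subseteq> {1, -1}" for i
    by (auto simp: S_def)
  have finS: "finite (S i)" for i
    by (rule finite_subset[OF S]) simp
  have AS: "A = signed_axes S"
  proof
    show "A \<subseteq> signed_axes S"
    proof
      fix a assume "a \<in> A"
      moreover obtain i s where "a = axis i s" "s \<in> {1, -1}"
        using A \<open>a \<in> A\<close> unfolding signed_axes_def by blast
      ultimately show "a \<in> signed_axes S"
        unfolding signed_axes_def S_def by blast
    qed
  qed (auto simp: S_def signed_axes_def)
  have "card A = (\<Sum>i\<in>UNIV. card (axis i ` S i))"
    unfolding AS signed_axes_def 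
  proof (rule card_UN_disjoint)
    show "\<forall>i\<in>UNIV. \<forall>j\<in>UNIV. i \<noteq> j \<longrightarrow> axis i ` S i \<inter> axis j ` S j = {}"
      using S by (fastforce simp: axis_eq_axis)
  qed (use finS in auto)
  also have "\<dots> = (\<Sum>i\<in>UNIV. card (S i))"
    by (intro sum.cong card_image) (auto simp: inj_on_def axis_eq_axis)
  finally have cA: "card A = (\<Sum>i\<in>UNIV. card (S i))" .
  have "(\<Prod>i\<in>UNIV. card (S i)) \<le> 2 ^ (n - CARD('d))"
  proof (cases "\<forall>i. S i \<noteq> {}")
    case True
    have c12: "card (S i) \<in> {1, 2}" for i
    proof -
      have "card (S i) \<le> card {1, -1 :: real}"
        by (intro card_mono S) auto
      moreover have "card (S i) \<noteq> 0"
        using True finS by simp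
      ultimately show ?thesis by auto
    qed
    \<comment> \<open>Each factor is 1 or 2, and \<open>k = 2 ^ (k - 1)\<close> for these two
      values.\<close>
    have "(\<Prod>i\<in>UNIV. card (S i)) = (\<Prod>i\<in>UNIV. 2 ^ (card (S i) - 1))"
    proof (intro prod.cong refl)
      fix i show "card (S i) = 2 ^ (card (S i) - 1)" using c12[of i] by auto
    qed
    also have "\<dots> = 2 ^ (\<Sum>i\<in>UNIV. card (S i) - 1)"
      by (simp add: power_sum)
    also have "(\<Sum>i\<in>UNIV. card (S i) - 1) = card A - CARD('d)"
      unfolding cA
    proof (subst sum_subtractf_nat)
      fix i show "1 \<le> card (S i)" using c12[of i] by auto
    qed simp
    also have "2 ^ (card A - CARD('d)) \<le> (2::nat) ^ (n - CARD('d))"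
      using n by (intro power_increasing) auto
    finally show ?thesis .
  next
    case False
    then obtain i where "S i = {}" by blast
    then have "(\<Prod>i\<in>UNIV. card (S i)) = 0"
      by (intro prod_zero) (auto intro!: exI[of _ i])
    then show ?thesis by (simp only: zero_le)
  qed
  then have "real (\<Prod>i\<in>UNIV. card (S i)) \<le> 2 ^ (n - CARD('d))"
    by (metis of_nat_le_iff of_nat_numeral of_nat_power)
  then have "(\<Prod>i\<in>UNIV. card (S i)) / fact CARD('d) \<le> 2 ^ (n - CARD('d)) / fact CARD('d)"
    by (intro divide_right_mono) auto
  with measure_convex_hull_signed_axes_le[of S, OF S] show ?thesis
    unfolding AS by (rule order_trans)
qed

subsection \<open>Cross-polytopes\<close>

text \<open>The linear map taking the \<open>i\<close>-th unit vector to \<open>q i\<close>, so its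
  matrix has the vectors \<open>q i\<close> as columns.\<close>

definition frame :: "('d::finite \<Rightarrow> real^'d) \<Rightarrow> real^'d \<Rightarrow> real^'d" where
  "frame q x = (\<Sum>i\<in>UNIV. x $ i *\<^sub>R q i)"

abbreviation std_cross_polytope :: "(real^'d::finite) set" where
  "std_cross_polytope \<equiv> convex hull (signed_axes (\<lambda>_. {1, -1}))"

lemma linear_frame: "linear (frame q)"
  by (intro linearI) (simp_all add: frame_def scaleR_add_left sum.distrib scaleR_sum_right)

lemma frame_axis [simp]: "frame q (axis i s) = s *\<^sub>R q i"
  by (simp add: frame_def axis_def if_distrib[of "\<lambda>s. s *\<^sub>R x" for x] cong: if_cong)

lemma det_matrix_frame: "det (matrix (frame q)) = det (\<chi> i. q i)"
proof -
  have "matrix (frame q) = transpose (\<chi> i. q i)"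
    by (simp add: matrix_def transpose_def vec_eq_iff)
  then show ?thesis
    by (simp add: det_transpose)
qed

lemma inj_frame_iff: "inj (frame q) \<longleftrightarrow> inj q \<and> independent (range q)"
proof
  assume inj: "inj (frame q)"
  have "inj q"
  proof (rule injI)
    fix i j assume "q i = q j"
    then have "frame q (axis i 1) = frame q (axis j 1)"
      by simp
    then have "axis i 1 = (axis j 1 :: real^'a)"
      using inj by (rule injD[rotated])
    then show "i = j"
      by (simp add: axis_eq_axis)
  qed
  have "range q = frame q ` Basis"
    by (auto simp: Basis_vec_def image_iff)
  moreover have "independent (frame q ` Basis)"
    by (intro linear_independent_injective_image linear_frame independent_Basis
        inj_on_subset[OF inj] subset_UNIV)
  ultimately show "inj q \<and> independent (range q)"
    using \<open>inj q\<close> by simp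
next
  assume q: "inj q \<and> independent (range q)"
  show "inj (frame q)"
    unfolding linear_injective_0[OF linear_frame]
  proof (intro allI impI)
    fix x assume "frame q x = 0"
    then have "(\<Sum>v\<in>range q. x $ (inv q v) *\<^sub>R v) = 0"
      using q by (simp add: frame_def sum.reindex)
    then have "x $ (inv q v) = 0" if "v \<in> range q" for v
      using independentD[of "range q" "range q" "\<lambda>v. x $ (inv q v)" v] q that by simp
    then show "x = 0"
      using q by (force simp: vec_eq_iff)
  qed
qed

lemma signed_axes_frame:
  "frame q ` signed_axes (\<lambda>_. {1, -1}) = range q \<union> uminus ` range q"
  unfolding signed_axes_def image_UN image_image by auto

text \<open>This reduces volumes of cross-polytopes and of hulls of their vertices to the standard
  cross-polytope and a determinant.\<close>

lemma cross_polytope_iff_frame: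
  "cross_polytope C \<longleftrightarrow> (\<exists>q. det (matrix (frame q)) \<noteq> 0 \<and> C = frame q ` std_cross_polytope)"
  unfolding cross_polytope_def det_nz_iff_inj[OF linear_frame] inj_frame_iff
  by (simp add: convex_hull_linear_image[OF linear_frame] signed_axes_frame)

lemma zero_in_std_cross_polytope: "0 \<in> (std_cross_polytope :: (real^'d::finite) set)"
  by (rule zero_in_convex_hull_signed_axes) auto

lemma measure_frame_convex_hull:
  fixes A :: "(real^'d::finite) set"
  assumes "finite A"
  shows "measure lebesgue (convex hull (frame q ` A))
    = \<bar>det (matrix (frame q))\<bar> * measure lebesgue (convex hull A)"
  unfolding convex_hull_linear_image[OF linear_frame, symmetric]
  by (intro measure_linear_image_compact linear_frame finite_imp_compact_convex_hull assms)

lemma measure_frame_std_cross_polytope: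
  fixes q :: "'d::finite \<Rightarrow> real^'d"
  shows "measure lebesgue (frame q ` std_cross_polytope)
    = \<bar>det (matrix (frame q))\<bar> * (2 ^ CARD('d) / fact CARD('d))"
proof -
  have "measure lebesgue (std_cross_polytope :: (real^'d) set) = 2 ^ CARD('d) / fact CARD('d)"
    by (subst measure_convex_hull_signed_axes) (auto simp: zero_in_std_cross_polytope)
  moreover have "finite (signed_axes (\<lambda>_. {1, -1}) :: (real^'d) set)"
    by (rule finite_signed_axes) simp
  ultimately show ?thesis
    unfolding convex_hull_linear_image[OF linear_frame] by (simp add: measure_frame_convex_hull)
qed

section \<open>Existence of a maximum volume cross-polytope\<close>

text \<open>The volume is a constant times the absolute determinant of the spanning vectors, a
  continuous function on a compact set of matrices. This makes the choice in
  \<open>max_cross_polytope\<close> meaningful.\<close>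

lemma ex_max_cross_polytope:
  fixes B :: "(real^'d::finite) set"
  assumes B: "B \<in> sym_convex_bodies"
  shows "\<exists>C. is_max_cross_polytope B C"
proof -
  have cB: "compact B" "convex B" "interior B \<noteq> {}" "uminus ` B = B"
    using B by (auto simp: sym_convex_bodies_def)
  \<comment> \<open>The rows range over all of \<open>B\<close>, dependent ones included, so that
    \<open>K\<close> is closed; singular matrices are excluded only at the maximiser.\<close>
  define K where "K = {Q :: real^'d^'d. \<forall>i. Q $ i \<in> B}"
  have "compact K"
  proof -
    have "K = (\<Inter>i. (\<lambda>Q. Q $ i) -` B)"
      by (auto simp: K_def)
    moreover have "closed ((\<lambda>Q :: real^'d^'d. Q $ i) -` B)" for i
      using cB(1) by (intro closed_vimage compact_imp_closed continuous_intros)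
    ultimately have "closed K" by auto
    obtain b where b: "\<And>x. x \<in> B \<Longrightarrow> norm x \<le> b"
      using compact_imp_bounded[OF cB(1)] bounded_iff by metis
    have "norm Q \<le> real CARD('d) * b" if "Q \<in> K" for Q
    proof -
      have "norm Q \<le> (\<Sum>i\<in>UNIV. norm (Q $ i))"
        unfolding norm_vec_def by (rule L2_set_le_sum) simp
      also have "\<dots> \<le> (\<Sum>i\<in>(UNIV::'d set). b)"
        using that b by (intro sum_mono) (auto simp: K_def)
      finally show ?thesis by simp
    qed
    then have "bounded K"
      unfolding bounded_iff by blast
    with \<open>closed K\<close> show ?thesis
      by (simp add: compact_eq_bounded_closed)
  qed
  \<comment> \<open>A body with interior points spans the space, so it contains a basis and the
    maximal determinant is not zero.\<close>
  have "\<not> dim B < DIM(real^'d)"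
    using empty_interior_lowdim cB(3) by blast
  then have "dim B = CARD('d)"
    using dim_subset_UNIV[of B] by simp
  then obtain E where E: "E \<subseteq> B" "independent E" "card E = CARD('d)"
    using basis_exists[of B] by metis
  then have "finite E"
    using independent_imp_finite by blast
  then obtain q0 where q0: "bij_betw q0 (UNIV :: 'd set) E"
    using E(3) finite_same_card_bij[of "UNIV::'d set" E] by auto
  have "inj (frame q0)"
    unfolding inj_frame_iff using q0 E(2) by (auto simp: bij_betw_def)
  then have q0_det: "det (\<chi> i. q0 i) \<noteq> 0"
    using det_nz_iff_inj[OF linear_frame] by (metis det_matrix_frame)
  have q0K: "(\<chi> i. q0 i) \<in> K"
    using q0 E(1) by (auto simp: K_def bij_betw_def)
  have "continuous_on K (\<lambda>Q. \<bar>det Q\<bar>)"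
    unfolding det_def by (intro continuous_intros)
  then obtain Q where Q: "Q \<in> K" "\<And>Q'. Q' \<in> K \<Longrightarrow> \<bar>det Q'\<bar> \<le> \<bar>det Q\<bar>"
    using continuous_attains_sup[OF \<open>compact K\<close>] q0K by blast
  then have "det Q \<noteq> 0"
    using q0_det q0K by fastforce
  let ?C = "frame (\<lambda>i. Q $ i) ` std_cross_polytope"
  have "cross_polytope ?C"
    unfolding cross_polytope_iff_frame using \<open>det Q \<noteq> 0\<close>
    by (intro exI[of _ "\<lambda>i. Q $ i"]) (simp add: det_matrix_frame)
  moreover have "?C \<subseteq> B"
    unfolding convex_hull_linear_image[OF linear_frame] signed_axes_frame
  proof (rule hull_minimal)
    have "range (($) Q) \<subseteq> B"
      using Q(1) by (auto simp: K_def)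
    then show "range (($) Q) \<union> uminus ` range (($) Q) \<subseteq> B"
      using cB(4) by blast
  qed (rule cB(2))
  moreover have "measure lebesgue C' \<le> measure lebesgue ?C" if C': "cross_polytope C'" "C' \<subseteq> B" for C'
  proof -
    obtain q where q: "C' = frame q ` std_cross_polytope"
      using C'(1) cross_polytope_iff_frame by blast
    have "range q \<subseteq> B"
      using C'(2) hull_subset[of "range q \<union> uminus ` range q" convex]
      unfolding q convex_hull_linear_image[OF linear_frame] signed_axes_frame by blast
    then have "(\<chi> i. q i) \<in> K"
      by (auto simp: K_def)
    then have "\<bar>det (\<chi> i. q i)\<bar> \<le> \<bar>det Q\<bar>"
      by (rule Q(2))
    then show ?thesis
      unfolding q measure_frame_std_cross_polytope det_matrix_frame
      by (intro mult_right_mono) auto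
  qed
  ultimately show ?thesis
    unfolding is_max_cross_polytope_def by blast
qed

section \<open>Polytopes with few vertices inside a cross-polytope\<close>

lemma ex_subpolytope_with_few_vertices:
  fixes q :: "'d::finite \<Rightarrow> real^'d"
  assumes n: "CARD('d) + 1 \<le> n" "n \<le> 2 * CARD('d)"
  obtains Q where "polytope Q" "Q \<subseteq> frame q ` std_cross_polytope" "card {v. v extreme_point_of Q} \<le> n"
    "measure lebesgue Q = \<bar>det (matrix (frame q))\<bar> * (2 ^ (n - CARD('d)) / fact CARD('d))"
proof -
  obtain D :: "'d set" where D: "card D = n - CARD('d)"
    using n by (auto intro: obtain_subset_with_card_n[of "n - CARD('d)" "UNIV :: 'd set"])
  \<comment> \<open>Both signs on the \<open>n - CARD('d)\<close> axes in \<open>D\<close> and one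
    sign on each of the others give exactly \<open>n\<close> points before applying
    \<open>frame q\<close>.\<close>
  define S where "S = (\<lambda>i. if i \<in> D then {1, -1 :: real} else {1})"
  have S: "S i \<subseteq> {1, -1}" for i
    by (auto simp: S_def)
  let ?A = "frame q ` signed_axes S"
  have fin: "finite (signed_axes S)"
    by (rule finite_signed_axes[of S, OF S])
  \<comment> \<open>Here \<open>n\<close> being at least \<open>CARD('d) + 1\<close> matters: one
    antipodal pair puts the origin into the hull.\<close>
  obtain i where "i \<in> D"
    using D n by fastforce
  then have 0: "0 \<in> convex hull (signed_axes S)"
    by (intro zero_in_convex_hull_signed_axes[of _ i]) (auto simp: S_def)
  have card: "card (S i) = (if i \<in> D then 2 else 1)" for i
    by (simp add: S_def)
  have "(\<Prod>i\<in>UNIV. card (S i)) = 2 ^ card D"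
    unfolding card by (simp add: prod.If_cases)
  then have "real (\<Prod>i\<in>UNIV. card (S i)) = 2 ^ (n - CARD('d))"
    unfolding D by simp
  then have m: "measure lebesgue (convex hull ?A) = \<bar>det (matrix (frame q))\<bar> * (2 ^ (n - CARD('d)) / fact CARD('d))"
    using measure_convex_hull_signed_axes[of S, OF S 0] by (simp add: measure_frame_convex_hull[OF fin])
  have "card (signed_axes S) \<le> (\<Sum>i\<in>UNIV. card (axis i ` S i))"
    unfolding signed_axes_def by (rule card_UN_le) simp
  also have "\<dots> \<le> (\<Sum>i\<in>UNIV. card (S i))"
    using S by (intro sum_mono card_image_le finite_subset[OF S]) simp
  also have "\<dots> = (\<Sum>i\<in>UNIV. 1 + (if i \<in> D then 1 else 0))"
    unfolding card by (intro sum.cong) auto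
  also have "\<dots> = n"
    using n D by (subst sum.distrib) (simp add: sum.If_cases)
  finally have "card ?A \<le> n"
    using card_image_le[OF fin, of "frame q"] by linarith
  moreover have "card {v. v extreme_point_of (convex hull ?A)} \<le> card ?A"
    using fin by (intro card_mono) (auto dest: extreme_point_of_convex_hull)
  ultimately have "card {v. v extreme_point_of (convex hull ?A)} \<le> n"
    by linarith
  moreover have "signed_axes S \<subseteq> signed_axes (\<lambda>_. {1, -1})"
    using S unfolding signed_axes_def by blast
  then have "convex hull ?A \<subseteq> frame q ` std_cross_polytope"
    unfolding convex_hull_linear_image[OF linear_frame] by (intro hull_mono image_mono)
  moreover have "polytope (convex hull ?A)"
    using fin by (simp add: polytope_convex_hull)
  ultimately show thesis
    using that m by blast
qed

lemma measure_polytope_in_cross_polytope_le: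
  fixes q :: "'d::finite \<Rightarrow> real^'d"
  assumes n: "CARD('d) \<le> n" and Q: "polytope Q" "Q \<subseteq> frame q ` std_cross_polytope"
    and card: "card {v. v extreme_point_of Q} \<le> n"
  shows "measure lebesgue Q \<le> \<bar>det (matrix (frame q))\<bar> * (2 ^ (n - CARD('d)) / fact CARD('d))"
proof -
  let ?P = "{v. v extreme_point_of Q}"
  have QP: "Q = convex hull ?P"
    using Q(1) by (intro Krein_Milman_Minkowski polytope_imp_compact polytope_imp_convex)
  have "finite ?P"
    using Q(1) finite_polyhedron_extreme_points polytope_imp_polyhedron by blast
  have "measure lebesgue (convex hull ?P)
      \<le> \<bar>det (matrix (frame q))\<bar> * (2 ^ (n - CARD('d)) / fact CARD('d))"
  proof (rule measure_convex_hull_le_of_vertices[OF _ \<open>finite ?P\<close> _ card])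
    show "?P \<subseteq> convex hull (frame q ` signed_axes (\<lambda>_. {1, -1}))"
      using Q(2) unfolding convex_hull_linear_image[OF linear_frame]
      by (auto simp: extreme_point_of_def)
    fix A assume A: "A \<subseteq> frame q ` signed_axes (\<lambda>_. {1, -1})" "card A \<le> n"
    \<comment> \<open>\<open>frame q\<close> may be singular, so \<open>A'\<close> is chosen to
      contain one preimage per point; it then has the same cardinality as \<open>A\<close>.\<close>
    then obtain A' where A': "A' \<subseteq> signed_axes (\<lambda>_. {1, -1})" "inj_on (frame q) A'" "A = frame q ` A'"
      by (auto simp: subset_image_inj)
    have "finite A'"
      using A'(1) by (rule finite_subset) (auto intro: finite_signed_axes)
    have "measure lebesgue (convex hull A') \<le> 2 ^ (n - CARD('d)) / fact CARD('d)"
      using A' A(2) n by (intro measure_convex_hull_subset_signed_axes) (auto simp: card_image)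
    then show "measure lebesgue (convex hull A) \<le> \<bar>det (matrix (frame q))\<bar> * (2 ^ (n - CARD('d)) / fact CARD('d))"
      unfolding A'(3) measure_frame_convex_hull[OF \<open>finite A'\<close>] by (intro mult_left_mono) auto
  qed
  then show ?thesis
    unfolding QP[symmetric] .
qed

section \<open>Gromov's mass and the extremal values\<close>

text \<open>The factor \<open>2 ^ CARD('d) / fact CARD('d)\<close> cancels against the volume of the
  standard cross-polytope, leaving only the determinant of the maximiser.\<close>

lemma gromov_mass_max_cross_polytope:
  fixes B :: "(real^'d::finite) set"
  assumes B: "B \<in> sym_convex_bodies"
  obtains q where "det (matrix (frame q)) \<noteq> 0" "is_max_cross_polytope B (frame q ` std_cross_polytope)"
    "\<And>S. gromov_mass B S = measure lebesgue S / \<bar>det (matrix (frame q))\<bar>"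
proof -
  have max: "is_max_cross_polytope B (max_cross_polytope B)"
    unfolding max_cross_polytope_def using ex_max_cross_polytope[OF B] by (rule someI_ex)
  then obtain q where q: "det (matrix (frame q)) \<noteq> 0" "max_cross_polytope B = frame q ` std_cross_polytope"
    unfolding is_max_cross_polytope_def cross_polytope_iff_frame by blast
  have "gromov_mass B S = measure lebesgue S / \<bar>det (matrix (frame q))\<bar>" for S
    unfolding gromov_mass_def q(2) measure_frame_std_cross_polytope by simp
  with that q max show thesis
    by metis
qed

text \<open>By monotonicity the mass of \<open>B\<close> itself is an upper bound, so the real
  supremum in \<open>gromov_mu\<close> is genuine.\<close>

lemma bdd_above_gromov_mass:
  fixes B :: "(real^'d::finite) set"
  assumes B: "B \<in> sym_convex_bodies"
  shows "bdd_above {gromov_mass B Q | Q. polytope Q \<and> Q \<subseteq> B \<and> card {v. v extreme_point_of Q} \<le> n}"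
proof (rule bdd_aboveI)
  fix m assume "m \<in> {gromov_mass B Q | Q. polytope Q \<and> Q \<subseteq> B \<and> card {v. v extreme_point_of Q} \<le> n}"
  then obtain Q where Q: "m = gromov_mass B Q" "polytope Q" "Q \<subseteq> B" by blast
  have "measure lebesgue Q \<le> measure lebesgue B"
    using B Q by (intro measure_mono_fmeasurable)
      (auto simp: sym_convex_bodies_def lmeasurable_compact polytope_imp_compact fmeasurableD)
  then show "m \<le> gromov_mass B B"
    unfolding Q(1) gromov_mass_def by (intro mult_left_mono divide_right_mono) auto
qed

text \<open>The witness is a subpolytope of the maximum volume cross-polytope. Capping
  \<open>n\<close> at \<open>2 * CARD('d)\<close> treats both ranges at once: from there on the
  whole cross-polytope is used.\<close>

lemma gromov_mu_ge:
  fixes B :: "(real^'d::finite) set"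
  assumes B: "B \<in> sym_convex_bodies" and n: "CARD('d) + 1 \<le> n"
  shows "2 ^ (min n (2 * CARD('d)) - CARD('d)) / fact CARD('d) \<le> gromov_mu n B"
proof -
  obtain q where q: "det (matrix (frame q)) \<noteq> 0" "is_max_cross_polytope B (frame q ` std_cross_polytope)"
    "\<And>S. gromov_mass B S = measure lebesgue S / \<bar>det (matrix (frame q))\<bar>"
    using gromov_mass_max_cross_polytope[OF B] by blast
  have "0 < CARD('d)" by simp
  then have "CARD('d) + 1 \<le> min n (2 * CARD('d))"
    using n by linarith
  then obtain Q where Q: "polytope Q" "Q \<subseteq> frame q ` std_cross_polytope"
    "card {v. v extreme_point_of Q} \<le> min n (2 * CARD('d))"
    "measure lebesgue Q = \<bar>det (matrix (frame q))\<bar> * (2 ^ (min n (2 * CARD('d)) - CARD('d)) / fact CARD('d))"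
    using ex_subpolytope_with_few_vertices[of "min n (2 * CARD('d))" q] by auto
  have "gromov_mass B Q \<le> gromov_mu n B"
    unfolding gromov_mu_def
    using Q q(2) by (intro cSup_upper bdd_above_gromov_mass[OF B]) (auto simp: is_max_cross_polytope_def)
  then show ?thesis
    using q(1) unfolding q(3) Q(4) by simp
qed

lemma gromov_mu_cross_polytope:
  fixes B :: "(real^'d::finite) set"
  assumes B: "B \<in> sym_convex_bodies" "cross_polytope B" and n: "CARD('d) + 1 \<le> n"
  shows "gromov_mu n B = 2 ^ (min n (2 * CARD('d)) - CARD('d)) / fact CARD('d)"
proof (rule antisym[OF _ gromov_mu_ge[OF B(1) n]])
  obtain q where q: "det (matrix (frame q)) \<noteq> 0" "is_max_cross_polytope B (frame q ` std_cross_polytope)"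
    "\<And>S. gromov_mass B S = measure lebesgue S / \<bar>det (matrix (frame q))\<bar>"
    using gromov_mass_max_cross_polytope[OF B(1)] by blast
  obtain p where p: "B = frame p ` std_cross_polytope"
    using B(2) cross_polytope_iff_frame by blast
  \<comment> \<open>\<open>B\<close> is a cross-polytope contained in itself, so it competes with
    the chosen maximiser.\<close>
  have "measure lebesgue B \<le> measure lebesgue (frame q ` std_cross_polytope)"
    using q(2) B(2) by (auto simp: is_max_cross_polytope_def)
  then have pq: "\<bar>det (matrix (frame p))\<bar> \<le> \<bar>det (matrix (frame q))\<bar>"
    unfolding p measure_frame_std_cross_polytope by (rule mult_right_le_imp_le) simp
  \<comment> \<open>The empty polytope shows that the supremum is over a nonempty set.\<close>
  have "\<exists>Q. polytope Q \<and> Q \<subseteq> B \<and> card {v. v extreme_point_of Q} \<le> n"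
    by (intro exI[of _ "{}"]) (simp add: polytope_empty)
  moreover have "gromov_mass B Q \<le> 2 ^ (min n (2 * CARD('d)) - CARD('d)) / fact CARD('d)"
    if Q: "polytope Q" "Q \<subseteq> B" "card {v. v extreme_point_of Q} \<le> n" for Q
  proof -
    have "measure lebesgue Q
        \<le> \<bar>det (matrix (frame p))\<bar> * (2 ^ (min n (2 * CARD('d)) - CARD('d)) / fact CARD('d))"
    \<comment> \<open>Beyond \<open>2 * CARD('d)\<close> vertices the bound is the volume of
      \<open>B\<close>, and inclusion suffices.\<close>
    proof (cases "n \<le> 2 * CARD('d)")
      case True
      then show ?thesis
        using measure_polytope_in_cross_polytope_le[of n Q p] n Q p by simp
    next
      case False
      have "measure lebesgue Q \<le> measure lebesgue B"
        using B Q by (intro measure_mono_fmeasurable)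
          (auto simp: sym_convex_bodies_def lmeasurable_compact polytope_imp_compact fmeasurableD)
      with False show ?thesis
        unfolding p measure_frame_std_cross_polytope by simp
    qed
    also have "\<dots> \<le> \<bar>det (matrix (frame q))\<bar> * (2 ^ (min n (2 * CARD('d)) - CARD('d)) / fact CARD('d))"
      using pq by (intro mult_right_mono) auto
    finally show ?thesis
      using q(1) unfolding q(3) by (simp add: divide_le_eq mult.commute)
  qed
  ultimately show "gromov_mu n B \<le> 2 ^ (min n (2 * CARD('d)) - CARD('d)) / fact CARD('d)"
    unfolding gromov_mu_def by (intro cSup_least) blast+
qed

lemma frame_std_cross_polytope_in_sym_convex_bodies:
  fixes q :: "'d::finite \<Rightarrow> real^'d"
  assumes "det (matrix (frame q)) \<noteq> 0"
  shows "frame q ` std_cross_polytope \<in> sym_convex_bodies"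
proof -
  let ?C = "frame q ` std_cross_polytope"
  have hull: "?C = convex hull (range q \<union> uminus ` range q)"
    unfolding convex_hull_linear_image[OF linear_frame] signed_axes_frame ..
  have "compact ?C" "convex ?C"
    unfolding hull by (auto intro!: finite_imp_compact_convex_hull)
  moreover have "uminus ` ?C = ?C"
  proof -
    have "uminus ` ?C = convex hull (uminus ` (range q \<union> uminus ` range q))"
      unfolding hull by (rule convex_hull_linear_image) (simp add: linear_uminus)
    also have "uminus ` (range q \<union> uminus ` range q) = range q \<union> uminus ` range q"
      by (auto simp: image_Un image_image)
    finally show ?thesis
      unfolding hull .
  qed
  \<comment> \<open>A convex set with empty interior is negligible, but the volume of
    \<open>?C\<close> is a positive multiple of a nonzero determinant.\<close>
  moreover have "interior ?C \<noteq> {}"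
  proof
    assume "interior ?C = {}"
    then have "negligible ?C"
      using \<open>convex ?C\<close> negligible_convex_interior by blast
    then show False
      using assms measure_frame_std_cross_polytope[of q] by (simp add: negligible_imp_measure0)
  qed
  ultimately show ?thesis
    by (simp add: sym_convex_bodies_def)
qed

text \<open>The lower bound valid for all bodies is attained at a cross-polytope, so the infimum is
  a minimum.\<close>

lemma gromov_m_eq:
  assumes n: "CARD('d::finite) + 1 \<le> n"
  shows "gromov_m n TYPE('d) = 2 ^ (min n (2 * CARD('d)) - CARD('d)) / fact CARD('d)"
proof -
  \<comment> \<open>With the unit vectors as frame, \<open>frame q\<close> is the identity, and the
    minimiser is the standard cross-polytope.\<close>
  define q where "q = (\<lambda>i::'d. axis i (1::real))"
  have "frame q x = x" for x
    by (simp add: frame_def q_def vec_eq_iff axis_def if_distrib cong: if_cong)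
  then have "inj (frame q)"
    by (simp add: inj_def)
  then have q: "det (matrix (frame q)) \<noteq> 0"
    by (simp add: det_nz_iff_inj linear_frame)
  let ?B = "frame q ` std_cross_polytope"
  have "?B \<in> sym_convex_bodies" "cross_polytope ?B"
    using q frame_std_cross_polytope_in_sym_convex_bodies cross_polytope_iff_frame by blast+
  then show ?thesis
    unfolding gromov_m_def using gromov_mu_cross_polytope[of ?B n] gromov_mu_ge n
    by (intro cInf_eq_minimum) (auto intro!: exI[of _ ?B])
qed

theorem theorem5p4:
  assumes "CARD('d::finite) \<ge> 3"
  shows
    "(\<forall>n \<ge> 2 * CARD('d).
        gromov_m n TYPE('d) = 2 ^ CARD('d) / fact CARD('d) \<and>
        (\<forall>B \<in> (sym_convex_bodies :: (real^'d) set set).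
           cross_polytope B \<longrightarrow> gromov_mu n B = gromov_m n TYPE('d))) \<and>
     (\<forall>n. CARD('d) + 1 \<le> n \<and> n \<le> 2 * CARD('d) - 1 \<longrightarrow>
        gromov_m n TYPE('d) = 2 ^ CARD('d) / (fact CARD('d) * 2 ^ (2 * CARD('d) - n)) \<and>
        (\<forall>B \<in> (sym_convex_bodies :: (real^'d) set set).
           cross_polytope B \<longrightarrow> gromov_mu n B = gromov_m n TYPE('d)))"
proof (intro conjI allI impI ballI)
  fix n assume n: "2 * CARD('d) \<le> n"
  then have n': "CARD('d) + 1 \<le> n"
    using assms by linarith
  show "gromov_m n TYPE('d) = 2 ^ CARD('d) / fact CARD('d)"
    using gromov_m_eq[OF n'] n by (simp add: min_def)
  show "gromov_mu n B = gromov_m n TYPE('d)"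
    if "B \<in> (sym_convex_bodies :: (real^'d) set set)" "cross_polytope B" for B
    using gromov_m_eq[OF n'] gromov_mu_cross_polytope[OF that n'] by simp
next
  fix n assume n: "CARD('d) + 1 \<le> n \<and> n \<le> 2 * CARD('d) - 1"
  then have n': "CARD('d) + 1 \<le> n" and le: "n \<le> 2 * CARD('d)"
    by linarith+
  \<comment> \<open>Splitting \<open>CARD('d)\<close> as the sum of \<open>n - CARD('d)\<close> and
    \<open>2 * CARD('d) - n\<close> turns the exponent of \<open>gromov_m_eq\<close> into the stated
    quotient.\<close>
  have "(2::real) ^ CARD('d) = 2 ^ (n - CARD('d)) * 2 ^ (2 * CARD('d) - n)"
    using n' le by (simp flip: power_add)
  then show "gromov_m n TYPE('d) = 2 ^ CARD('d) / (fact CARD('d) * 2 ^ (2 * CARD('d) - n))"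
    using gromov_m_eq[OF n'] le by (simp add: min_def)
  show "gromov_mu n B = gromov_m n TYPE('d)"
    if "B \<in> (sym_convex_bodies :: (real^'d) set set)" "cross_polytope B" for B
    using gromov_m_eq[OF n'] gromov_mu_cross_polytope[OF that n'] by simp
qed

end
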